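(* The triple $\langle F,U,\phi\rangle$ is an adjunction from $\mathbf{K}_R$ to $\mathbf{K}_{\mathrm{alg}}$; that is, for all $\mathbf{X}\in\mathcal{K}_R$ and $\mathbf{A}\in\mathcal{K}_{\mathrm{alg}}$, the map $\phi_{\mathbf{X},\mathbf{A}}:\mathbf{K}_{\mathrm{alg}}(F\mathbf{X},\mathbf{A})\to\mathbf{K}_R(\mathbf{X},U\mathbf{A})$, $\phi_{\mathbf{X},\mathbf{A}}(f)=Uf\circ\eta_{\mathbf{X}}$, is a bijection, natural in $\mathbf{X}$ and $\mathbf{A}$.
   Context: Setting: $L$ is a first-order language with set of function symbols $L_{\mathrm{alg}}$ and an $n$-ary relation symbol $R$; $\mathcal{K}$ is a class of $L$-structures and there are $L$-terms $t_1,\dots,t_m,s_1,\dots,s_m$ in $x_1,\dots,x_n$ with $\mathcal{K}\models\forall\bar x\,(R(\bar x)\iff\bigwedge_{i=1}^m t_i(\bar x)=s_i(\bar x))$. $\mathcal{K}_{\mathrm{alg}}$, $\mathcal{K}_R$ are the classes of reducts of members of $\mathcal{K}$ to $L_{\mathrm{alg}}$ and to $\{R\}$, with categories $\mathbf{K}_{\mathrm{alg}}$, $\mathbf{K}_R$ of homomorphisms (for $\mathbf{K}_R$: $R$-preserving maps); $\mathcal{K}_{\mathrm{alg}}$ is assumed to be a variety. $U:\mathbf{K}_{\mathrm{alg}}\to\mathbf{K}_R$ sends $\mathbf{A}$ to $(A,R^{\mathbf{A}})$ with $\bar a\in R^{\mathbf{A}}$ iff $\mathbf{A}\models\bigwedge_i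 t_i(\bar a)=s_i(\bar a)$, and morphisms to the same maps. For a set $X$, $\mathbf{F}_{\mathcal{K}}(X)=T(X)/\delta_X$ is the free $\mathcal{K}_{\mathrm{alg}}$-algebra over $X$ ($T(X)$ the term algebra, $\delta_X$ the least congruence with quotient in $\mathcal{K}_{\mathrm{alg}}$, $[t]$ the class of $t$). For $\mathbf{X}\in\mathcal{K}_R$, $\theta_{\mathbf{X}}$ is the congruence of $\mathbf{F}_{\mathcal{K}}(X)$ generated by the pairs $\langle[t_i(\bar x)],[s_i(\bar x)]\rangle$ for $1\le i\le m$ and $\bar x\in R^{\mathbf{X}}$; $F\mathbf{X}=\mathbf{F}_{\mathcal{K}}(X)/\theta_{\mathbf{X}}$; for a $\mathbf{K}_R$-morphism $f:\mathbf{X}\to\mathbf{Y}$, $Ff([t(\bar x)]/\theta_{\mathbf{X}})=[t(f(\bar x))]/\theta_{\mathbf{Y}}$. $\eta_{\mathbf{X}}:\mathbf{X}\to UF\mathbf{X}$ is $\eta_{\mathbf{X}}(a)=[a]/\theta_{\mathbf{X}}$. *)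

theory Defs
  imports "HOL-Library.FuncSet"
begin

section \<open>Terms, algebras, relational structures, first-order structures\<close>

datatype ('f, 'v) trm = Var 'v | App 'f "('f, 'v) trm list"

inductive_set terms :: "('f \<Rightarrow> nat) \<Rightarrow> 'v set \<Rightarrow> ('f, 'v) trm set"
  for ar :: "'f \<Rightarrow> nat" and X :: "'v set" where
  "x \<in> X \<Longrightarrow> Var x \<in> terms ar X"
| "length ts = ar f \<Longrightarrow> \<forall>t\<in>set ts. t \<in> terms ar X \<Longrightarrow> App f ts \<in> terms ar X"

definition tuples :: "nat \<Rightarrow> 'a set \<Rightarrow> 'a list set" where
  "tuples k S = {xs. length xs = k \<and> set xs \<subseteq> S}"

record ('f, 'a) alg =
  car :: "'a set"
  interp :: "'f \<Rightarrow> 'a list \<Rightarrow> 'a"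

record ('f, 'a) lstruct = "('f, 'a) alg" +
  srel :: "'a list set"

record 'a relstr =
  univ :: "'a set"
  rel :: "'a list set"

text \<open>Operations are extensional (undefined off the tuples of the right length over the
  carrier), so that equality of records is equality of algebras.  As usual for first-order
  structures, carriers are nonempty.\<close>

definition is_alg :: "('f \<Rightarrow> nat) \<Rightarrow> ('f, 'a, 'z) alg_scheme \<Rightarrow> bool" where
  "is_alg ar A \<longleftrightarrow> car A \<noteq> {} \<and> (\<forall>f. interp A f \<in> tuples (ar f) (car A) \<rightarrow>\<^sub>E car A)"

definition is_lstruct :: "('f \<Rightarrow> nat) \<Rightarrow> nat \<Rightarrow> ('f, 'a) lstruct \<Rightarrow> bool" where
  "is_lstruct ar n M \<longleftrightarrow> is_alg ar M \<and> srel M \<subseteq> tuples n (car M)"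

primrec eval :: "('f, 'a, 'z) alg_scheme \<Rightarrow> ('v \<Rightarrow> 'a) \<Rightarrow> ('f, 'v) trm \<Rightarrow> 'a" where
  "eval A v (Var x) = v x"
| "eval A v (App f ts) = interp A f (map (eval A v) ts)"

text \<open>The algebraic and the relational reducts of a class of structures.\<close>

definition Kalg :: "('f, 'a) lstruct set \<Rightarrow> ('f, 'a) alg set" where
  "Kalg K = alg.truncate ` K"

definition Krel :: "('f, 'a) lstruct set \<Rightarrow> 'a relstr set" where
  "Krel K = (\<lambda>M. \<lparr>univ = car M, rel = srel M\<rparr>) ` K"

text \<open>Morphisms are extensional functions on the carriers, composed by \<open>compose\<close>.\<close>

definition hom_alg ::
  "('f \<Rightarrow> nat) \<Rightarrow> ('f, 'a) alg \<Rightarrow> ('f, 'b) alg \<Rightarrow> ('a \<Rightarrow> 'b) set" where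
  "hom_alg ar A B = {h \<in> car A \<rightarrow>\<^sub>E car B.
     \<forall>f. \<forall>xs \<in> tuples (ar f) (car A). h (interp A f xs) = interp B f (map h xs)}"

definition hom_rel :: "'a relstr \<Rightarrow> 'b relstr \<Rightarrow> ('a \<Rightarrow> 'b) set" where
  "hom_rel X Y = {h \<in> univ X \<rightarrow>\<^sub>E univ Y. \<forall>xs \<in> rel X. map h xs \<in> rel Y}"


section \<open>Varieties\<close>

definition identities :: "('f \<Rightarrow> nat) \<Rightarrow> (('f, nat) trm \<times> ('f, nat) trm) set" where
  "identities ar = terms ar UNIV \<times> terms ar UNIV"

definition Mod :: "('f \<Rightarrow> nat) \<Rightarrow> (('f, nat) trm \<times> ('f, nat) trm) set \<Rightarrow> ('f, 'a) alg set" where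
  "Mod ar E = {A. is_alg ar A \<and>
     (\<forall>(p, q)\<in>E. \<forall>v. range v \<subseteq> car A \<longrightarrow> eval A v p = eval A v q)}"

definition variety :: "('f \<Rightarrow> nat) \<Rightarrow> ('f, 'a) alg set \<Rightarrow> bool" where
  "variety ar V \<longleftrightarrow> (\<exists>E \<subseteq> identities ar. V = Mod ar E)"

text \<open>A set \<open>V\<close> of algebras has members over one type \<open>'a\<close> only, whereas quotients of term
  algebras live over other types.  The class of algebras that a variety \<open>V\<close> consists of is
  therefore read at an arbitrary type \<open>'b\<close> as the class of models of the identities of \<open>V\<close>;
  at \<open>'b = 'a\<close> this is \<open>V\<close> itself whenever \<open>variety ar V\<close>.\<close>

definition in_variety :: "('f \<Rightarrow> nat) \<Rightarrow> ('f, 'a) alg set \<Rightarrow> ('f, 'b) alg \<Rightarrow> bool" where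
  "in_variety ar V B \<longleftrightarrow> B \<in> Mod ar {e \<in> identities ar. V \<subseteq> Mod ar {e}}"


section \<open>Congruences, quotients, free algebras\<close>

definition congruence :: "('f \<Rightarrow> nat) \<Rightarrow> ('f, 'a) alg \<Rightarrow> ('a \<times> 'a) set \<Rightarrow> bool" where
  "congruence ar A \<theta> \<longleftrightarrow> equiv (car A) \<theta> \<and>
     (\<forall>f. \<forall>xs \<in> tuples (ar f) (car A). \<forall>ys \<in> tuples (ar f) (car A).
        list_all2 (\<lambda>x y. (x, y) \<in> \<theta>) xs ys \<longrightarrow> (interp A f xs, interp A f ys) \<in> \<theta>)"

definition congruence_generated ::
  "('f \<Rightarrow> nat) \<Rightarrow> ('f, 'a) alg \<Rightarrow> ('a \<times> 'a) set \<Rightarrow> ('a \<times> 'a) set" where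
  "congruence_generated ar A S = \<Inter>{\<theta>. congruence ar A \<theta> \<and> S \<subseteq> \<theta>}"

text \<open>The value of an operation at blocks \<open>Cs\<close> is the block of its value at any choice of
  representatives \<open>xs\<close> of \<open>Cs\<close>.\<close>

definition quotient_alg ::
  "('f \<Rightarrow> nat) \<Rightarrow> ('f, 'a) alg \<Rightarrow> ('a \<times> 'a) set \<Rightarrow> ('f, 'a set) alg" where
  "quotient_alg ar A \<theta> =
     \<lparr>car = car A // \<theta>,
      interp = (\<lambda>f. \<lambda>Cs \<in> tuples (ar f) (car A // \<theta>).
        {y. \<exists>xs. list_all2 (\<in>) xs Cs \<and> (interp A f xs, y) \<in> \<theta>})\<rparr>"

definition term_alg :: "('f \<Rightarrow> nat) \<Rightarrow> 'v set \<Rightarrow> ('f, ('f, 'v) trm) alg" where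
  "term_alg ar X =
     \<lparr>car = terms ar X, interp = (\<lambda>f. \<lambda>ts \<in> tuples (ar f) (terms ar X). App f ts)\<rparr>"

text \<open>The least congruence whose quotient lies in \<open>V\<close>; the intersection is itself such a congruence,
  since its quotient is a subdirect product of the quotients by the congruences intersected.\<close>

definition delta ::
  "('f \<Rightarrow> nat) \<Rightarrow> ('f, 'a) alg set \<Rightarrow> 'v set \<Rightarrow> (('f, 'v) trm \<times> ('f, 'v) trm) set" where
  "delta ar V X =
     \<Inter>{\<theta>. congruence ar (term_alg ar X) \<theta> \<and> in_variety ar V (quotient_alg ar (term_alg ar X) \<theta>)}"

definition free_alg ::
  "('f \<Rightarrow> nat) \<Rightarrow> ('f, 'a) alg set \<Rightarrow> 'v set \<Rightarrow> ('f, ('f, 'v) trm set) alg" where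
  "free_alg ar V X = quotient_alg ar (term_alg ar X) (delta ar V X)"

text \<open>The image in the free algebra of a term.\<close>

definition fcls ::
  "('f \<Rightarrow> nat) \<Rightarrow> ('f, 'a) alg set \<Rightarrow> 'v set \<Rightarrow> ('f, 'v) trm \<Rightarrow> ('f, 'v) trm set" where
  "fcls ar V X t = delta ar V X `` {t}"


section \<open>The functors and the adjunction\<close>

text \<open>The list \<open>eqs\<close> consists of the pairs \<open>(t\<^sub>i, s\<^sub>i)\<close>.  The variables of these terms are the
  numbers \<open>j < n\<close>, the \<open>j\<close>-th one denoting the entry \<open>xs ! j\<close> of a tuple \<open>xs\<close>.\<close>

definition inst :: "'v list \<Rightarrow> ('f, nat) trm \<Rightarrow> ('f, 'v) trm" where
  "inst xs t = map_trm id ((!) xs) t"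

definition solutions ::
  "nat \<Rightarrow> (('f, nat) trm \<times> ('f, nat) trm) list \<Rightarrow> ('f, 'a, 'z) alg_scheme \<Rightarrow> 'a list set" where
  "solutions n eqs A =
     {xs \<in> tuples n (car A). \<forall>(t, s) \<in> set eqs. eval A ((!) xs) t = eval A ((!) xs) s}"

definition U_obj ::
  "nat \<Rightarrow> (('f, nat) trm \<times> ('f, nat) trm) list \<Rightarrow> ('f, 'a) alg \<Rightarrow> 'a relstr" where
  "U_obj n eqs A = \<lparr>univ = car A, rel = solutions n eqs A\<rparr>"

definition U_mor :: "('a \<Rightarrow> 'b) \<Rightarrow> ('a \<Rightarrow> 'b)" where
  "U_mor f = f"

definition theta ::
  "('f \<Rightarrow> nat) \<Rightarrow> ('f, 'a) alg set \<Rightarrow> (('f, nat) trm \<times> ('f, nat) trm) list \<Rightarrow> 'v relstr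
    \<Rightarrow> (('f, 'v) trm set \<times> ('f, 'v) trm set) set" where
  "theta ar V eqs X = congruence_generated ar (free_alg ar V (univ X))
     {(fcls ar V (univ X) (inst xs t), fcls ar V (univ X) (inst xs s)) | t s xs.
        (t, s) \<in> set eqs \<and> xs \<in> rel X}"

definition F_obj ::
  "('f \<Rightarrow> nat) \<Rightarrow> ('f, 'a) alg set \<Rightarrow> (('f, nat) trm \<times> ('f, nat) trm) list \<Rightarrow> 'v relstr
    \<Rightarrow> ('f, ('f, 'v) trm set set) alg" where
  "F_obj ar V eqs X = quotient_alg ar (free_alg ar V (univ X)) (theta ar V eqs X)"

text \<open>\<open>[t]/\<theta>\<^sub>X\<close>\<close>

definition cls ::
  "('f \<Rightarrow> nat) \<Rightarrow> ('f, 'a) alg set \<Rightarrow> (('f, nat) trm \<times> ('f, nat) trm) list \<Rightarrow> 'v relstr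
    \<Rightarrow> ('f, 'v) trm \<Rightarrow> ('f, 'v) trm set set" where
  "cls ar V eqs X t = theta ar V eqs X `` {fcls ar V (univ X) t}"

text \<open>The description below is proper (that is, \<open>F_mor\<close> is well defined) if \<open>f\<close> is a morphism
  from \<open>X\<close> to \<open>Y\<close>.\<close>

definition F_mor ::
  "('f \<Rightarrow> nat) \<Rightarrow> ('f, 'a) alg set \<Rightarrow> (('f, nat) trm \<times> ('f, nat) trm) list
    \<Rightarrow> 'v relstr \<Rightarrow> 'w relstr \<Rightarrow> ('v \<Rightarrow> 'w)
    \<Rightarrow> ('f, 'v) trm set set \<Rightarrow> ('f, 'w) trm set set" where
  "F_mor ar V eqs X Y f = (\<lambda>C \<in> car (F_obj ar V eqs X).
     THE D. \<exists>t \<in> terms ar (univ X). C = cls ar V eqs X t \<and> D = cls ar V eqs Y (map_trm id f t))"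

definition eta ::
  "('f \<Rightarrow> nat) \<Rightarrow> ('f, 'a) alg set \<Rightarrow> (('f, nat) trm \<times> ('f, nat) trm) list \<Rightarrow> 'v relstr
    \<Rightarrow> 'v \<Rightarrow> ('f, 'v) trm set set" where
  "eta ar V eqs X = (\<lambda>a \<in> univ X. cls ar V eqs X (Var a))"

definition phi ::
  "('f \<Rightarrow> nat) \<Rightarrow> ('f, 'a) alg set \<Rightarrow> (('f, nat) trm \<times> ('f, nat) trm) list \<Rightarrow> 'v relstr
    \<Rightarrow> (('f, 'v) trm set set \<Rightarrow> 'b) \<Rightarrow> 'v \<Rightarrow> 'b" where
  "phi ar V eqs X f = compose (univ X) (U_mor f) (eta ar V eqs X)"

end

(* Everything follows from the universal property of F X among all algebras B of the variety,
   over any type: a relation-preserving map g from X to U B extends to a homomorphism from F X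
   to B.  Evaluation of terms at g is a homomorphism from the term algebra to B, whose kernel
   contains delta because the image lies in the variety, and it identifies the generators of
   theta because g maps related tuples to solutions.  Extensions are unique because F X is
   generated by the image of eta.  With B = F Y this gives the action of F on morphisms, and
   its uniqueness gives functoriality. *)
theory Submission
  imports Defs
begin

section \<open>Terms and homomorphisms\<close>

text \<open>With the map to classes in place of \<open>f\<close>, this chooses representatives for a
  whole tuple of classes at once.\<close>

lemma tuples_image: "tuples k (f ` S) = map f ` tuples k S"
proof
  show "tuples k (f ` S) \<subseteq> map f ` tuples k S"
  proof
    fix ys assume "ys \<in> tuples k (f ` S)"
    then have "ys \<in> lists (f ` S)" and l: "length ys = k"
      by (auto simp: tuples_def)
    then obtain xs where "ys = map f xs" "xs \<in> lists S"
      unfolding lists_image by auto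
    with l show "ys \<in> map f ` tuples k S"
      by (auto simp: tuples_def)
  qed
qed (auto simp: tuples_def subset_iff)

lemma interp_closed:
  "is_alg ar A \<Longrightarrow> xs \<in> tuples (ar f) (car A) \<Longrightarrow> interp A f xs \<in> car A"
  unfolding is_alg_def by (metis PiE_mem)

lemma eval_closed:
  assumes "t \<in> terms ar X" "is_alg ar A" "v ` X \<subseteq> car A"
  shows "eval A v t \<in> car A"
  using assms(1)
proof induction
  case (1 x)
  with assms show ?case by auto
next
  case (2 ts f)
  then have "map (eval A v) ts \<in> tuples (ar f) (car A)"
    by (auto simp: tuples_def)
  with assms show ?case by (simp add: interp_closed)
qed

text \<open>Valuations are often comparable only on the variables at hand: list indexing is
  determined only below the length, extensional maps only on their domain.\<close>

lemma eval_cong: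
  assumes "t \<in> terms ar X" "\<And>x. x \<in> X \<Longrightarrow> v x = w x"
  shows "eval A v t = eval A w t"
  using assms(1)
proof induction
  case (2 ts f)
  then have "map (eval A v) ts = map (eval A w) ts" by simp
  then show ?case by (simp only: eval.simps)
qed (simp add: assms)

lemma hom_eval:
  assumes "t \<in> terms ar X" "is_alg ar A" "h \<in> hom_alg ar A B" "v ` X \<subseteq> car A"
  shows "h (eval A v t) = eval B (\<lambda>x. h (v x)) t"
  using assms(1)
proof induction
  case (2 ts f)
  then have "map (eval A v) ts \<in> tuples (ar f) (car A)"
    using assms eval_closed by (fastforce simp: tuples_def)
  then have "h (eval A v (App f ts)) = interp B f (map h (map (eval A v) ts))"
    using assms(3) by (simp add: hom_alg_def)
  also have "map h (map (eval A v) ts) = map (eval B (\<lambda>x. h (v x))) ts"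
    using 2 by simp
  finally show ?case by simp
qed simp

lemma eval_map_trm: "eval A v (map_trm id g t) = eval A (\<lambda>x. v (g x)) t"
proof (induction t)
  case (App f ts)
  then have "map (eval A v) (map (map_trm id g) ts) = map (eval A (\<lambda>x. v (g x))) ts"
    by (simp del: id_apply)
  then show ?case by (simp only: eval.simps trm.map id_def)
qed simp

lemma map_trm_terms:
  assumes "t \<in> terms ar X" "g ` X \<subseteq> Y"
  shows "map_trm id g t \<in> terms ar Y"
  using assms(1) by induction (use assms(2) in \<open>auto intro!: terms.intros\<close>)

lemma eval_truncate: "eval (alg.truncate M) v t = eval M v t"
proof (induction t)
  case (App f ts)
  then have "map (eval (alg.truncate M) v) ts = map (eval M v) ts" by simp
  then show ?case by (simp only: eval.simps) (simp add: alg.truncate_def)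
qed simp

lemma is_alg_truncate: "is_alg ar (alg.truncate M) \<longleftrightarrow> is_alg ar M"
  by (simp add: is_alg_def alg.truncate_def)

lemma is_alg_term_alg:
  assumes "X \<noteq> {}"
  shows "is_alg ar (term_alg ar X)"
  using assms by (auto simp: is_alg_def term_alg_def tuples_def intro!: terms.intros)

text \<open>Pushed through the two quotient maps, this shows that the class of a term is its value
  at the classes of the variables.\<close>

lemma eval_term_alg:
  assumes "t \<in> terms ar X"
  shows "eval (term_alg ar X) Var t = t"
  using assms
proof induction
  case (2 ts f)
  then have "map (eval (term_alg ar X) Var) ts = ts" by (simp add: map_idI)
  with 2 show ?case by (auto simp: term_alg_def tuples_def)
qed simp

lemma eval_hom_term_alg:
  assumes "is_alg ar B" "v ` X \<subseteq> car B"
  shows "(\<lambda>t \<in> terms ar X. eval B v t) \<in> hom_alg ar (term_alg ar X) B"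
proof -
  have "map (\<lambda>t \<in> terms ar X. eval B v t) ts = map (eval B v) ts"
    and "App f ts \<in> terms ar X"
    if "ts \<in> tuples (ar f) (terms ar X)" for f ts
    using that by (auto simp: tuples_def intro!: terms.intros)
  then show ?thesis
    using assms by (auto simp: hom_alg_def term_alg_def eval_closed simp del: map_eq_conv)
qed

section \<open>Composition of morphisms and the action of \<open>U\<close>\<close>

lemma hom_alg_compose:
  assumes "is_alg ar A" "h \<in> hom_alg ar A B" "k \<in> hom_alg ar B C"
  shows "compose (car A) k h \<in> hom_alg ar A C"
proof -
  have "compose (car A) k h (interp A f xs) = interp C f (map (compose (car A) k h) xs)"
    if xs: "xs \<in> tuples (ar f) (car A)" for f xs
  proof -
    have "map h xs \<in> tuples (ar f) (car B)"
      using xs assms(2) by (auto simp: tuples_def hom_alg_def)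
    then have "k (interp B f (map h xs)) = interp C f (map k (map h xs))"
      using assms(3) by (simp add: hom_alg_def)
    moreover have "map k (map h xs) = map (compose (car A) k h) xs"
      using xs by (auto simp: tuples_def compose_eq)
    ultimately show ?thesis
      using xs assms by (simp add: compose_eq interp_closed hom_alg_def del: map_map map_eq_conv)
  qed
  moreover have "compose (car A) k h \<in> car A \<rightarrow>\<^sub>E car C"
    using assms by (auto simp: hom_alg_def compose_def)
  ultimately show ?thesis by (simp add: hom_alg_def)
qed

lemma hom_rel_compose:
  assumes "h \<in> hom_rel X Y" "k \<in> hom_rel Y Z" "\<forall>xs \<in> rel X. set xs \<subseteq> univ X"
  shows "compose (univ X) k h \<in> hom_rel X Z"
proof -
  have "map (compose (univ X) k h) xs = map k (map h xs)" if "xs \<in> rel X" for xs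
    using bspec[OF assms(3) that] by (auto simp: compose_eq subset_iff)
  with assms(1,2) have "\<forall>xs \<in> rel X. map (compose (univ X) k h) xs \<in> rel Z"
    by (simp add: hom_rel_def del: map_map)
  with assms(1,2) show ?thesis by (auto simp: hom_rel_def compose_def)
qed

text \<open>Homomorphisms commute with the evaluation of terms, so an equation solved by a tuple is
  solved by its image.\<close>

lemma hom_alg_hom_rel:
  assumes "set eqs \<subseteq> terms ar {..<n} \<times> terms ar {..<n}" "is_alg ar A" "h \<in> hom_alg ar A B"
  shows "h \<in> hom_rel (U_obj n eqs A) (U_obj n eqs B)"
proof -
  have "map h xs \<in> solutions n eqs B" if xs: "xs \<in> solutions n eqs A" for xs
  proof -
    have len: "length xs = n" and sub: "(!) xs ` {..<n} \<subseteq> car A"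
      using xs by (auto simp: solutions_def tuples_def)
    \<comment> \<open>The valuation \<open>(!) (map h xs)\<close> is known to agree with
      \<open>h\<close> after \<open>(!) xs\<close> only at indices below \<open>n\<close>; hence the
      bound on the variables of \<open>t\<close>.\<close>
    have ev: "eval B ((!) (map h xs)) t = h (eval A ((!) xs) t)" if "t \<in> terms ar {..<n}" for t
      unfolding hom_eval[OF that assms(2,3) sub]
      by (rule eval_cong[OF that]) (simp add: len)
    have "eval B ((!) (map h xs)) t = eval B ((!) (map h xs)) s" if "(t, s) \<in> set eqs" for t s
    proof -
      have "t \<in> terms ar {..<n}" "s \<in> terms ar {..<n}" using that assms(1) by auto
      moreover have "eval A ((!) xs) t = eval A ((!) xs) s"
        using that xs by (auto simp: solutions_def)
      ultimately show ?thesis by (simp add: ev)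
    qed
    moreover have "map h xs \<in> tuples n (car B)"
      using xs assms(3) by (auto simp: solutions_def tuples_def hom_alg_def)
    ultimately show ?thesis by (auto simp: solutions_def)
  qed
  with assms(3) show ?thesis by (auto simp: hom_rel_def U_obj_def hom_alg_def)
qed


section \<open>Congruences and quotients\<close>

text \<open>Nonemptiness of \<open>S\<close> matters: the empty intersection is the universal
  relation on the type, which may exceed the carrier.\<close>

lemma congruence_Inter:
  assumes "\<And>\<theta>. \<theta> \<in> S \<Longrightarrow> congruence ar A \<theta>" "S \<noteq> {}"
  shows "congruence ar A (\<Inter>S)"
proof -
  have eq: "\<And>\<theta>. \<theta> \<in> S \<Longrightarrow> equiv (car A) \<theta>" using assms(1) by (simp add: congruence_def)
  have "equiv (car A) (\<Inter>S)"
  proof (rule equivI)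
    show "\<Inter>S \<subseteq> car A \<times> car A" using eq assms(2) using equiv_type by blast
    show "refl_on (car A) (\<Inter>S)" using eq by (auto simp: refl_on_def equiv_def)
    show "sym (\<Inter>S)" using eq by (auto simp: sym_def equiv_def)
    show "trans (\<Inter>S)" using eq unfolding equiv_def trans_def by blast
  qed
  moreover have "(interp A f xs, interp A f ys) \<in> \<theta>"
    if "xs \<in> tuples (ar f) (car A)" "ys \<in> tuples (ar f) (car A)"
      "list_all2 (\<lambda>x y. (x, y) \<in> \<Inter>S) xs ys" "\<theta> \<in> S" for f xs ys \<theta>
  proof -
    have "list_all2 (\<lambda>x y. (x, y) \<in> \<theta>) xs ys"
      using that(3) by (rule list_all2_mono) (use that(4) in auto)
    with that assms(1) show ?thesis by (simp add: congruence_def)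
  qed
  ultimately show ?thesis by (simp add: congruence_def)
qed

text \<open>Supplies a member of the families whose intersections are
  \<open>congruence_generated\<close> and \<open>delta\<close>.\<close>

lemma congruence_full:
  assumes "is_alg ar A"
  shows "congruence ar A (car A \<times> car A)"
  using interp_closed[OF assms]
  by (auto simp: congruence_def equiv_def refl_on_def sym_def trans_def)

text \<open>As least congruences, \<open>delta\<close> and \<open>theta\<close> lie below every
  suitable kernel; this is how homomorphisms are made to factor through the quotients.\<close>

lemma congruence_kernel:
  assumes "is_alg ar A" "h \<in> hom_alg ar A B"
  shows "congruence ar A {(x, y). x \<in> car A \<and> y \<in> car A \<and> h x = h y}"
proof -
  have "h (interp A f xs) = h (interp A f ys)"
    if "xs \<in> tuples (ar f) (car A)" "ys \<in> tuples (ar f) (car A)"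
      "list_all2 (\<lambda>x y. x \<in> car A \<and> y \<in> car A \<and> h x = h y) xs ys" for f xs ys
  proof -
    have "map h xs = map h ys"
      using that(3) by (auto simp: list_eq_iff_nth_eq list_all2_conv_all_nth)
    with that assms(2) show ?thesis by (simp add: hom_alg_def)
  qed
  then show ?thesis
    using interp_closed[OF assms(1)]
    by (auto simp: congruence_def equiv_def refl_on_def sym_def trans_def)
qed

lemma congruence_generated:
  assumes "is_alg ar A" "S \<subseteq> car A \<times> car A"
  shows "congruence ar A (congruence_generated ar A S)"
  unfolding congruence_generated_def
  using congruence_full[OF assms(1)] assms(2) by (intro congruence_Inter) auto

lemma generators_in_congruence_generated: "S \<subseteq> congruence_generated ar A S"
  by (auto simp: congruence_generated_def)

lemma congruence_generated_least:
  "congruence ar A \<theta> \<Longrightarrow> S \<subseteq> \<theta> \<Longrightarrow> congruence_generated ar A S \<subseteq> \<theta>"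
  by (auto simp: congruence_generated_def)

text \<open>The operation gathers the results of all choices of representatives. Compatibility puts
  them into one class, and \<open>xs\<close> itself is among the choices.\<close>

lemma quotient_interp:
  assumes "congruence ar A \<theta>" "xs \<in> tuples (ar f) (car A)"
  shows "interp (quotient_alg ar A \<theta>) f (map (\<lambda>x. \<theta> `` {x}) xs) = \<theta> `` {interp A f xs}"
proof -
  have eq: "equiv (car A) \<theta>" using assms by (simp add: congruence_def)
  have "(interp A f xs, interp A f zs) \<in> \<theta>"
    if "list_all2 (\<lambda>z x. (x, z) \<in> \<theta>) zs xs" for zs
  proof -
    have l: "list_all2 (\<lambda>x z. (x, z) \<in> \<theta>) xs zs"
      using that by (auto simp: list_all2_conv_all_nth)
    \<comment> \<open>A congruence relates only elements of the carrier, so another choice of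
      representatives is again a tuple over it.\<close>
    then have "zs \<in> tuples (ar f) (car A)"
      using assms(2) equiv_type[OF eq] by (fastforce simp: tuples_def list_all2_conv_all_nth in_set_conv_nth)
    with l assms show ?thesis by (simp add: congruence_def)
  qed
  moreover have "list_all2 (\<lambda>z x. (x, z) \<in> \<theta>) xs xs"
    using assms(2) eq by (auto simp: list_all2_same tuples_def equiv_def refl_on_def)
  ultimately have "(\<exists>zs. list_all2 (\<lambda>z x. (x, z) \<in> \<theta>) zs xs \<and> (interp A f zs, y) \<in> \<theta>)
      \<longleftrightarrow> (interp A f xs, y) \<in> \<theta>" for y
    using eq unfolding equiv_def by (meson transE)
  moreover have "map (\<lambda>x. \<theta> `` {x}) xs \<in> tuples (ar f) (car A // \<theta>)"
    using assms(2) by (auto simp: tuples_def quotient_def)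
  ultimately show ?thesis
    by (auto simp: quotient_alg_def list_all2_map2)
qed

lemma quotient_eq_image: "A // \<theta> = (\<lambda>x. \<theta> `` {x}) ` A"
  by (auto simp: quotient_def)

lemma is_alg_quotient:
  assumes "is_alg ar A" "congruence ar A \<theta>"
  shows "is_alg ar (quotient_alg ar A \<theta>)"
proof -
  have "interp (quotient_alg ar A \<theta>) f Cs \<in> car A // \<theta>"
    if Cs: "Cs \<in> tuples (ar f) (car A // \<theta>)" for f Cs
  proof -
    obtain xs where xs: "xs \<in> tuples (ar f) (car A)" "Cs = map (\<lambda>x. \<theta> `` {x}) xs"
      using Cs unfolding quotient_eq_image tuples_image by blast
    with interp_closed[OF assms(1) xs(1)] show ?thesis
      using quotient_interp[OF assms(2) xs(1)] by (simp add: quotientI)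
  qed
  moreover have "interp (quotient_alg ar A \<theta>) f \<in> extensional (tuples (ar f) (car A // \<theta>))" for f
    by (simp add: quotient_alg_def)
  moreover have "car (quotient_alg ar A \<theta>) = car A // \<theta>" by (simp add: quotient_alg_def)
  ultimately show ?thesis
    using assms(1) by (auto simp: is_alg_def PiE_def quotient_eq_image)
qed

lemma quotient_projection_hom:
  assumes "is_alg ar A" "congruence ar A \<theta>"
  shows "(\<lambda>x \<in> car A. \<theta> `` {x}) \<in> hom_alg ar A (quotient_alg ar A \<theta>)"
proof -
  have "map (\<lambda>x \<in> car A. \<theta> `` {x}) xs = map (\<lambda>x. \<theta> `` {x}) xs"
    if "xs \<in> tuples (ar f) (car A)" for f xs
    using that by (auto simp: tuples_def)
  moreover have "(\<lambda>x \<in> car A. \<theta> `` {x}) \<in> car A \<rightarrow>\<^sub>E car (quotient_alg ar A \<theta>)"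
    by (auto simp: quotient_alg_def quotientI)
  ultimately show ?thesis
    using assms by (simp add: hom_alg_def quotient_interp interp_closed del: map_eq_conv)
qed

lemma eval_quotient:
  assumes "t \<in> terms ar X" "is_alg ar A" "congruence ar A \<theta>" "v ` X \<subseteq> car A"
  shows "eval (quotient_alg ar A \<theta>) (\<lambda>x. \<theta> `` {v x}) t = \<theta> `` {eval A v t}"
proof -
  let ?p = "\<lambda>x \<in> car A. \<theta> `` {x}"
  have "\<theta> `` {eval A v t} = ?p (eval A v t)"
    using eval_closed[OF assms(1,2,4)] by simp
  also have "\<dots> = eval (quotient_alg ar A \<theta>) (\<lambda>x. ?p (v x)) t"
    by (rule hom_eval[OF assms(1,2) quotient_projection_hom[OF assms(2,3)] assms(4)])
  \<comment> \<open>Restricting \<open>?p\<close> to the carrier makes no difference here, since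
    \<open>v\<close> maps \<open>X\<close> into it.\<close>
  also have "\<dots> = eval (quotient_alg ar A \<theta>) (\<lambda>x. \<theta> `` {v x}) t"
    using assms(4) by (intro eval_cong[OF assms(1)]) auto
  finally show ?thesis by simp
qed

text \<open>The factorisation in the homomorphism theorem, applied later to \<open>delta\<close> and
  then to \<open>theta\<close>.\<close>

lemma quotient_lift:
  assumes "is_alg ar A" "congruence ar A \<theta>" "h \<in> hom_alg ar A B"
    and "\<And>x y. (x, y) \<in> \<theta> \<Longrightarrow> h x = h y"
  shows "\<exists>k \<in> hom_alg ar (quotient_alg ar A \<theta>) B. \<forall>x \<in> car A. k (\<theta> `` {x}) = h x"
proof
  \<comment> \<open>The representative is arbitrary; \<open>h\<close> is constant on classes, so the
    choice does not affect the value.\<close>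
  define k where "k = (\<lambda>C \<in> car A // \<theta>. h (SOME x. x \<in> C))"
  have k: "k (\<theta> `` {x}) = h x" if "x \<in> car A" for x
  proof -
    have "x \<in> \<theta> `` {x}"
      by (rule equiv_class_self[OF _ that]) (use assms(2) in \<open>simp add: congruence_def\<close>)
    then have "(SOME y. y \<in> \<theta> `` {x}) \<in> \<theta> `` {x}" by (rule someI)
    then have "h x = h (SOME y. y \<in> \<theta> `` {x})" by (intro assms(4)) blast
    with that show ?thesis by (simp add: k_def quotientI)
  qed
  then show "\<forall>x \<in> car A. k (\<theta> `` {x}) = h x" by blast
  have "k (interp (quotient_alg ar A \<theta>) f Cs) = interp B f (map k Cs)"
    if Cs: "Cs \<in> tuples (ar f) (car A // \<theta>)" for f Cs
  proof -
    obtain xs where xs: "xs \<in> tuples (ar f) (car A)" "Cs = map (\<lambda>x. \<theta> `` {x}) xs"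
      using Cs unfolding quotient_eq_image tuples_image by blast
    then have "map k Cs = map h xs" using k by (auto simp: tuples_def)
    moreover have "k (interp (quotient_alg ar A \<theta>) f Cs) = h (interp A f xs)"
      using xs assms k by (simp add: quotient_interp interp_closed)
    ultimately show ?thesis using xs(1) assms(3) by (simp add: hom_alg_def)
  qed
  moreover have "k \<in> car A // \<theta> \<rightarrow>\<^sub>E car B"
  proof (rule PiE_I)
    fix C assume "C \<in> car A // \<theta>"
    then obtain x where "x \<in> car A" "C = \<theta> `` {x}" by (rule quotientE)
    with k assms(3) show "k C \<in> car B" by (auto simp: hom_alg_def)
  qed (simp add: k_def)
  ultimately show "k \<in> hom_alg ar (quotient_alg ar A \<theta>) B"
    by (simp add: hom_alg_def quotient_alg_def)
qed

section \<open>Membership of quotients in the variety\<close>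

lemma Mod_quotient_iff:
  assumes "is_alg ar A" "congruence ar A \<theta>" "E \<subseteq> identities ar"
  shows "quotient_alg ar A \<theta> \<in> Mod ar E \<longleftrightarrow>
    (\<forall>(p, q) \<in> E. \<forall>v. range v \<subseteq> car A \<longrightarrow> (eval A v p, eval A v q) \<in> \<theta>)"
proof -
  let ?Q = "quotient_alg ar A \<theta>"
  have eq: "equiv (car A) \<theta>" using assms(2) by (simp add: congruence_def)
  \<comment> \<open>Choosing a representative for each variable shows that valuations in the
    quotient are exactly the classes of valuations in \<open>A\<close>; an identity then says that
    two values in \<open>A\<close> are related.\<close>
  have "(\<forall>w. range w \<subseteq> car ?Q \<longrightarrow> eval ?Q w p = eval ?Q w q) \<longleftrightarrow>
      (\<forall>v. range v \<subseteq> car A \<longrightarrow> (eval A v p, eval A v q) \<in> \<theta>)"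
    if "(p, q) \<in> E" for p q
  proof -
    have pq: "p \<in> terms ar UNIV" "q \<in> terms ar UNIV"
      using that assms(3) by (auto simp: identities_def)
    have *: "eval ?Q (\<lambda>i. \<theta> `` {v i}) p = eval ?Q (\<lambda>i. \<theta> `` {v i}) q
        \<longleftrightarrow> (eval A v p, eval A v q) \<in> \<theta>" if "range v \<subseteq> car A" for v
      using that pq assms eq
      by (simp add: eval_quotient eq_equiv_class_iff eval_closed)
    have **: "\<exists>v. range v \<subseteq> car A \<and> w = (\<lambda>i. \<theta> `` {v i})" if "range w \<subseteq> car ?Q" for w :: "nat \<Rightarrow> _"
    proof -
      have "\<forall>i. \<exists>x. x \<in> car A \<and> w i = \<theta> `` {x}"
        using that by (auto simp: quotient_alg_def quotient_eq_image)
      then obtain v where "\<forall>i. v i \<in> car A \<and> w i = \<theta> `` {v i}" by metis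
      then show ?thesis by auto
    qed
    have ***: "range (\<lambda>i. \<theta> `` {v i}) \<subseteq> car ?Q" if "range v \<subseteq> car A" for v :: "nat \<Rightarrow> _"
      using that by (auto simp: quotient_alg_def quotient_eq_image)
    show ?thesis using * ** *** by metis
  qed
  with is_alg_quotient[OF assms(1,2)] show ?thesis
    unfolding Mod_def by (simp add: case_prod_beta)
qed

lemma in_variety_is_alg: "in_variety ar V A \<Longrightarrow> is_alg ar A"
  by (simp add: in_variety_def Mod_def)

lemma Mod_eval: "A \<in> Mod ar E \<Longrightarrow> (p, q) \<in> E \<Longrightarrow> range v \<subseteq> car A \<Longrightarrow> eval A v p = eval A v q"
  unfolding Mod_def by blast

lemma in_variety_eval:
  assumes "in_variety ar V A" "(p, q) \<in> identities ar" "V \<subseteq> Mod ar {(p, q)}" "range v \<subseteq> car A"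
  shows "eval A v p = eval A v q"
  using assms unfolding in_variety_def by (intro Mod_eval[OF assms(1)[unfolded in_variety_def]]) auto

text \<open>The right side asks the congruence to contain a fixed set of pairs. Such a condition
  passes to intersections, which replaces an argument by subdirect products.\<close>

lemma in_variety_quotient_iff:
  assumes "is_alg ar A" "congruence ar A \<theta>"
  shows "in_variety ar V (quotient_alg ar A \<theta>) \<longleftrightarrow>
    (\<forall>(p, q) \<in> {e \<in> identities ar. V \<subseteq> Mod ar {e}}. \<forall>v. range v \<subseteq> car A
      \<longrightarrow> (eval A v p, eval A v q) \<in> \<theta>)"
  unfolding in_variety_def by (rule Mod_quotient_iff[OF assms]) auto

text \<open>The two sides of an identity are already equal in \<open>A\<close>, hence related by
  reflexivity. This carries membership from the free algebra to \<open>F X\<close>.\<close>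

lemma in_variety_quotient:
  assumes "in_variety ar V A" "congruence ar A \<theta>"
  shows "in_variety ar V (quotient_alg ar A \<theta>)"
  unfolding in_variety_quotient_iff[OF in_variety_is_alg[OF assms(1)] assms(2)]
proof clarify
  fix p q and v :: "nat \<Rightarrow> _"
  assume pq: "(p, q) \<in> identities ar" "V \<subseteq> Mod ar {(p, q)}" and v: "range v \<subseteq> car A"
  have "eval A v p = eval A v q"
    by (rule in_variety_eval[OF assms(1) pq v])
  moreover have "eval A v q \<in> car A"
    using pq(1) v in_variety_is_alg[OF assms(1)] by (auto simp: identities_def intro: eval_closed)
  ultimately show "(eval A v p, eval A v q) \<in> \<theta>"
    using assms(2) by (simp add: congruence_def equiv_def refl_on_def)
qed

lemma in_variety_self:
  assumes "\<forall>A \<in> V. is_alg ar A" "A \<in> V"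
  shows "in_variety ar V A"
  using assms unfolding in_variety_def Mod_def by fast

text \<open>The quotient is a copy of a subalgebra of \<open>B\<close> and inherits its identities:
  \<open>h\<close> sends both sides of an identity to the same element.\<close>

lemma in_variety_kernel:
  assumes "is_alg ar A" "h \<in> hom_alg ar A B" "in_variety ar V B"
  shows "in_variety ar V (quotient_alg ar A {(x, y). x \<in> car A \<and> y \<in> car A \<and> h x = h y})"
  unfolding in_variety_quotient_iff[OF assms(1) congruence_kernel[OF assms(1,2)]]
proof clarify
  fix p q and v :: "nat \<Rightarrow> _"
  assume pq: "(p, q) \<in> identities ar" "V \<subseteq> Mod ar {(p, q)}" and v: "range v \<subseteq> car A"
  have "range (\<lambda>i. h (v i)) \<subseteq> car B"
    using v assms(2) by (auto simp: hom_alg_def)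
  then have "eval B (\<lambda>i. h (v i)) p = eval B (\<lambda>i. h (v i)) q"
    by (rule in_variety_eval[OF assms(3) pq])
  then show "eval A v p \<in> car A \<and> eval A v q \<in> car A \<and> h (eval A v p) = h (eval A v q)"
    using pq(1) v assms(1,2) by (auto simp: identities_def hom_eval intro: eval_closed)
qed


section \<open>The free algebra\<close>

lemma congruence_delta:
  assumes "X \<noteq> {}"
  shows "congruence ar (term_alg ar X) (delta ar V X)"
    and "in_variety ar V (quotient_alg ar (term_alg ar X) (delta ar V X))"
proof -
  let ?T = "term_alg ar X"
  let ?S = "{\<theta>. congruence ar ?T \<theta> \<and> in_variety ar V (quotient_alg ar ?T \<theta>)}"
  note T = is_alg_term_alg[OF assms]
  \<comment> \<open>The one-element quotient satisfies every identity, so the family intersected in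
    \<open>delta\<close> is nonempty.\<close>
  have "in_variety ar V (quotient_alg ar ?T (car ?T \<times> car ?T))"
    unfolding in_variety_quotient_iff[OF T congruence_full[OF T]]
  proof clarify
    fix p q and v :: "nat \<Rightarrow> _"
    assume "(p, q) \<in> identities ar" and v: "range v \<subseteq> car ?T"
    then have "p \<in> terms ar UNIV" "q \<in> terms ar UNIV" by (simp_all add: identities_def)
    then show "eval ?T v p \<in> car ?T \<and> eval ?T v q \<in> car ?T"
      using v by (blast intro: eval_closed T)
  qed
  then have "?S \<noteq> {}" using congruence_full[OF T] by blast
  then show c: "congruence ar ?T (delta ar V X)"
    unfolding delta_def by (intro congruence_Inter) auto
  show "in_variety ar V (quotient_alg ar ?T (delta ar V X))"
    unfolding in_variety_quotient_iff[OF T c]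
  proof clarify
    fix p q and v :: "nat \<Rightarrow> _"
    assume pq: "(p, q) \<in> identities ar" "V \<subseteq> Mod ar {(p, q)}" and v: "range v \<subseteq> car ?T"
    \<comment> \<open>Each congruence of the family contains all instances of the identities, hence
      so does the intersection.\<close>
    have "(eval ?T v p, eval ?T v q) \<in> \<theta>" if "\<theta> \<in> ?S" for \<theta>
    proof -
      have "congruence ar ?T \<theta>" "in_variety ar V (quotient_alg ar ?T \<theta>)" using that by auto
      from this(2)[unfolded in_variety_quotient_iff[OF T this(1)]] pq v show ?thesis by blast
    qed
    then show "(eval ?T v p, eval ?T v q) \<in> delta ar V X"
      unfolding delta_def by (rule InterI)
  qed
qed

lemma in_variety_free_alg: "X \<noteq> {} \<Longrightarrow> in_variety ar V (free_alg ar V X)"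
  unfolding free_alg_def by (rule congruence_delta)

lemma is_alg_free_alg: "X \<noteq> {} \<Longrightarrow> is_alg ar (free_alg ar V X)"
  by (rule in_variety_is_alg[OF in_variety_free_alg])

lemma car_free_alg: "car (free_alg ar V X) = fcls ar V X ` terms ar X"
  by (simp add: free_alg_def quotient_alg_def quotient_eq_image term_alg_def fcls_def)

lemma eval_free_alg:
  assumes "X \<noteq> {}" "t \<in> terms ar X"
  shows "eval (free_alg ar V X) (\<lambda>x. fcls ar V X (Var x)) t = fcls ar V X t"
  using eval_quotient[OF assms(2) is_alg_term_alg congruence_delta(1), of X Var V]
    assms eval_term_alg[OF assms(2)]
  by (auto simp: free_alg_def fcls_def term_alg_def intro: terms.intros)

lemma free_alg_extend:
  assumes "X \<noteq> {}" "in_variety ar V B" "g ` X \<subseteq> car B"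
  shows "\<exists>h \<in> hom_alg ar (free_alg ar V X) B. \<forall>t \<in> terms ar X. h (fcls ar V X t) = eval B g t"
proof -
  let ?T = "term_alg ar X" and ?e = "\<lambda>t \<in> terms ar X. eval B g t"
  note T = is_alg_term_alg[OF assms(1)]
  have car: "car ?T = terms ar X" by (simp add: term_alg_def)
  have e: "?e \<in> hom_alg ar ?T B"
    using assms by (intro eval_hom_term_alg in_variety_is_alg)
  \<comment> \<open>The kernel of evaluation is one of the congruences intersected in
    \<open>delta\<close>, because its quotient lies in the variety.\<close>
  have "delta ar V X \<subseteq> {(x, y). x \<in> car ?T \<and> y \<in> car ?T \<and> ?e x = ?e y}"
    using congruence_kernel[OF T e] in_variety_kernel[OF T e assms(2)]
    unfolding delta_def by blast
  then have "\<And>x y. (x, y) \<in> delta ar V X \<Longrightarrow> ?e x = ?e y" by blast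
  from quotient_lift[OF T congruence_delta(1)[OF assms(1)] e this]
  show ?thesis by (simp add: free_alg_def fcls_def car)
qed


section \<open>The algebra presented by a relational structure\<close>

text \<open>Isolates the facts about \<open>X\<close> on which the construction rests, with
  \<open>X\<close> over a type of its own. Nonemptiness of the universe keeps the term algebra
  nonempty. \<open>V\<close> occurs in no assumption, so the locale predicate takes only the other
  parameters.\<close>

locale presentation =
  fixes ar :: "'f \<Rightarrow> nat" and V :: "('f, 'u) alg set" and n :: nat
    and eqs :: "(('f, nat) trm \<times> ('f, nat) trm) list" and X :: "'v relstr"
  assumes terms_eqs: "set eqs \<subseteq> terms ar {..<n} \<times> terms ar {..<n}"
    and univ_nonempty: "univ X \<noteq> {}"
    and rel_tuples: "rel X \<subseteq> tuples n (univ X)"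
begin

lemma inst_terms: "t \<in> terms ar {..<n} \<Longrightarrow> xs \<in> rel X \<Longrightarrow> inst xs t \<in> terms ar (univ X)"
  unfolding inst_def
  by (erule map_trm_terms) (use rel_tuples in \<open>auto simp: tuples_def subset_iff\<close>)

text \<open>Ensures that the full relation belongs to the family intersected in
  \<open>theta\<close>.\<close>

lemma generators_closed:
  "{(fcls ar V (univ X) (inst xs t), fcls ar V (univ X) (inst xs s)) | t s xs.
      (t, s) \<in> set eqs \<and> xs \<in> rel X}
    \<subseteq> car (free_alg ar V (univ X)) \<times> car (free_alg ar V (univ X))"
  using terms_eqs by (auto simp: car_free_alg intro!: imageI inst_terms)

lemma congruence_theta: "congruence ar (free_alg ar V (univ X)) (theta ar V eqs X)"
  unfolding theta_def
  by (rule congruence_generated[OF is_alg_free_alg[OF univ_nonempty] generators_closed])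

lemma in_variety_F_obj: "in_variety ar V (F_obj ar V eqs X)"
  unfolding F_obj_def
  by (rule in_variety_quotient[OF in_variety_free_alg[OF univ_nonempty] congruence_theta])

lemma is_alg_F_obj: "is_alg ar (F_obj ar V eqs X)"
  by (rule in_variety_is_alg[OF in_variety_F_obj])

lemma car_F_obj: "car (F_obj ar V eqs X) = cls ar V eqs X ` terms ar (univ X)"
  by (simp add: F_obj_def quotient_alg_def quotient_eq_image car_free_alg image_image cls_def)

text \<open>Evaluation commutes with both quotient maps. In effect, \<open>F X\<close> is generated
  by the classes of the variables.\<close>

lemma eval_F_obj:
  assumes "t \<in> terms ar (univ X)"
  shows "eval (F_obj ar V eqs X) (\<lambda>x. cls ar V eqs X (Var x)) t = cls ar V eqs X t"
proof -
  have "(\<lambda>x. fcls ar V (univ X) (Var x)) ` univ X \<subseteq> car (free_alg ar V (univ X))"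
    by (auto simp: car_free_alg intro!: imageI terms.intros)
  from eval_quotient[OF assms is_alg_free_alg[OF univ_nonempty] congruence_theta this]
  show ?thesis
    using eval_free_alg[OF univ_nonempty assms, of V] by (simp add: F_obj_def cls_def)
qed

lemma eta_closed: "a \<in> univ X \<Longrightarrow> eta ar V eqs X a \<in> car (F_obj ar V eqs X)"
  by (auto simp: eta_def car_F_obj intro!: imageI terms.intros)

lemma eval_eta:
  assumes "t \<in> terms ar (univ X)"
  shows "eval (F_obj ar V eqs X) (eta ar V eqs X) t = cls ar V eqs X t"
  unfolding eval_F_obj[OF assms, symmetric]
  by (rule eval_cong[OF assms]) (simp add: eta_def)

lemma cls_inst_eq:
  assumes "(t, s) \<in> set eqs" "xs \<in> rel X"
  shows "cls ar V eqs X (inst xs t) = cls ar V eqs X (inst xs s)"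
proof -
  have "(fcls ar V (univ X) (inst xs t), fcls ar V (univ X) (inst xs s)) \<in> theta ar V eqs X"
    unfolding theta_def
    by (rule subsetD[OF generators_in_congruence_generated]) (use assms in blast)
  moreover have "equiv (car (free_alg ar V (univ X))) (theta ar V eqs X)"
    using congruence_theta by (simp add: congruence_def)
  ultimately show ?thesis unfolding cls_def by (rule equiv_class_eq[rotated])
qed

text \<open>The value of a term at the image of \<open>xs\<close> is the class of its instance at
  \<open>xs\<close>, and \<open>theta\<close> identifies the instances of the two sides of each
  equation.\<close>

lemma eta_hom: "eta ar V eqs X \<in> hom_rel X (U_obj n eqs (F_obj ar V eqs X))"
proof -
  let ?F = "F_obj ar V eqs X" and ?\<eta> = "eta ar V eqs X"
  have "map ?\<eta> xs \<in> solutions n eqs ?F" if xs: "xs \<in> rel X" for xs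
  proof -
    have tup: "xs \<in> tuples n (univ X)" using xs rel_tuples by blast
    have ev: "eval ?F ((!) (map ?\<eta> xs)) t = cls ar V eqs X (inst xs t)"
      if t: "t \<in> terms ar {..<n}" for t
    proof -
      have "eval ?F ((!) (map ?\<eta> xs)) t = eval ?F (\<lambda>i. ?\<eta> (xs ! i)) t"
        using tup by (intro eval_cong[OF t]) (simp add: tuples_def)
      also have "\<dots> = eval ?F ?\<eta> (inst xs t)" by (simp add: inst_def eval_map_trm)
      also have "\<dots> = cls ar V eqs X (inst xs t)" by (rule eval_eta[OF inst_terms[OF t xs]])
      finally show ?thesis .
    qed
    have "eval ?F ((!) (map ?\<eta> xs)) t = eval ?F ((!) (map ?\<eta> xs)) s" if "(t, s) \<in> set eqs" for t s
      using that terms_eqs cls_inst_eq[OF that xs] by (auto simp: ev)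
    moreover have "map ?\<eta> xs \<in> tuples n (car ?F)"
      using tup eta_closed by (auto simp: tuples_def)
    ultimately show ?thesis by (auto simp: solutions_def)
  qed
  moreover have "?\<eta> \<in> univ X \<rightarrow>\<^sub>E car ?F"
    by (rule PiE_I, erule eta_closed) (simp add: eta_def)
  ultimately show ?thesis by (simp add: hom_rel_def U_obj_def)
qed

lemma hom_cls:
  assumes "h \<in> hom_alg ar (F_obj ar V eqs X) B" "t \<in> terms ar (univ X)"
  shows "h (cls ar V eqs X t) = eval B (\<lambda>x. h (eta ar V eqs X x)) t"
  using hom_eval[OF assms(2) is_alg_F_obj assms(1), of "eta ar V eqs X"] eta_closed
  by (auto simp: eval_eta[OF assms(2)])

text \<open>Every element is the class of a term, and \<open>hom_cls\<close> computes its image from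
  the values on generators. Injectivity of \<open>phi\<close> and the functor laws for
  \<open>F\<close> rest on this.\<close>

lemma hom_ext:
  assumes "h \<in> hom_alg ar (F_obj ar V eqs X) B" "k \<in> hom_alg ar (F_obj ar V eqs X) B"
    and "\<And>x. x \<in> univ X \<Longrightarrow> h (eta ar V eqs X x) = k (eta ar V eqs X x)"
  shows "h = k"
proof (rule extensionalityI[of _ "car (F_obj ar V eqs X)"])
  fix c assume "c \<in> car (F_obj ar V eqs X)"
  then obtain t where t: "t \<in> terms ar (univ X)" "c = cls ar V eqs X t" by (auto simp: car_F_obj)
  show "h c = k c"
    unfolding t(2) hom_cls[OF assms(1) t(1)] hom_cls[OF assms(2) t(1)]
    by (rule eval_cong[OF t(1)]) (rule assms(3))
qed (use assms in \<open>auto simp: hom_alg_def PiE_def\<close>)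

lemma F_obj_extend:
  assumes "in_variety ar V B" "g \<in> hom_rel X (U_obj n eqs B)"
  shows "\<exists>h \<in> hom_alg ar (F_obj ar V eqs X) B.
    \<forall>t \<in> terms ar (univ X). h (cls ar V eqs X t) = eval B g t"
proof -
  let ?A = "free_alg ar V (univ X)"
  note A = is_alg_free_alg[OF univ_nonempty, of ar V]
  have "g ` univ X \<subseteq> car B" using assms(2) by (auto simp: hom_rel_def U_obj_def)
  from free_alg_extend[OF univ_nonempty assms(1) this]
  obtain h where h: "h \<in> hom_alg ar ?A B"
    and ev: "\<And>t. t \<in> terms ar (univ X) \<Longrightarrow> h (fcls ar V (univ X) t) = eval B g t" by blast
  have "eval B g (inst xs t) = eval B g (inst xs s)"
    if "(t, s) \<in> set eqs" and xs: "xs \<in> rel X" for t s xs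
  proof -
    \<comment> \<open>Substituting the entries of \<open>xs\<close> and then evaluating at
      \<open>g\<close> amounts to evaluating at the tuple \<open>map g xs\<close>, which is a
      solution.\<close>
    have *: "eval B g (inst xs r) = eval B ((!) (map g xs)) r" if "r \<in> terms ar {..<n}" for r
      unfolding inst_def eval_map_trm
      by (rule eval_cong[OF that]) (use xs rel_tuples in \<open>auto simp: tuples_def\<close>)
    have "map g xs \<in> solutions n eqs B" using assms(2) xs by (auto simp: hom_rel_def U_obj_def)
    then have "eval B ((!) (map g xs)) t = eval B ((!) (map g xs)) s"
      using that(1) by (auto simp: solutions_def)
    moreover have "t \<in> terms ar {..<n}" "s \<in> terms ar {..<n}"
      using that(1) terms_eqs by auto
    ultimately show ?thesis by (simp add: *)
  qed
  then have gen: "{(fcls ar V (univ X) (inst xs t), fcls ar V (univ X) (inst xs s)) | t s xs.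
      (t, s) \<in> set eqs \<and> xs \<in> rel X} \<subseteq> {(x, y). x \<in> car ?A \<and> y \<in> car ?A \<and> h x = h y}"
    using terms_eqs by (auto simp: ev inst_terms car_free_alg subset_iff)
  have "theta ar V eqs X \<subseteq> {(x, y). x \<in> car ?A \<and> y \<in> car ?A \<and> h x = h y}"
    unfolding theta_def by (rule congruence_generated_least[OF congruence_kernel[OF A h] gen])
  then have "\<And>x y. (x, y) \<in> theta ar V eqs X \<Longrightarrow> h x = h y" by blast
  from quotient_lift[OF A congruence_theta h this] show ?thesis
    by (auto simp: F_obj_def cls_def car_free_alg ev)
qed

text \<open>Injectivity is \<open>hom_ext\<close>, and a preimage of \<open>g\<close> is the
  homomorphism extending it. Values of \<open>phi\<close> preserve relations because
  \<open>eta\<close> and the images of homomorphisms under \<open>U\<close> do.\<close>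

lemma phi_bij:
  assumes "in_variety ar V B"
  shows "bij_betw (phi ar V eqs X) (hom_alg ar (F_obj ar V eqs X) B) (hom_rel X (U_obj n eqs B))"
proof (rule bij_betw_imageI)
  have app: "phi ar V eqs X h x = h (eta ar V eqs X x)" if "x \<in> univ X" for h :: "_ \<Rightarrow> 'b" and x
    using that by (simp add: phi_def U_mor_def compose_eq)
  show "inj_on (phi ar V eqs X) (hom_alg ar (F_obj ar V eqs X) B)"
    by (rule inj_onI, erule (1) hom_ext) (metis app)
  show "phi ar V eqs X ` hom_alg ar (F_obj ar V eqs X) B = hom_rel X (U_obj n eqs B)"
  proof
    have "\<forall>xs \<in> rel X. set xs \<subseteq> univ X" using rel_tuples by (auto simp: tuples_def)
    then show "phi ar V eqs X ` hom_alg ar (F_obj ar V eqs X) B \<subseteq> hom_rel X (U_obj n eqs B)"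
      unfolding phi_def U_mor_def
      using hom_rel_compose[OF eta_hom hom_alg_hom_rel[OF terms_eqs is_alg_F_obj]] by blast
    show "hom_rel X (U_obj n eqs B) \<subseteq> phi ar V eqs X ` hom_alg ar (F_obj ar V eqs X) B"
    proof
      fix g assume g: "g \<in> hom_rel X (U_obj n eqs B)"
      from F_obj_extend[OF assms g] obtain h where h: "h \<in> hom_alg ar (F_obj ar V eqs X) B"
        and ev: "\<And>t. t \<in> terms ar (univ X) \<Longrightarrow> h (cls ar V eqs X t) = eval B g t" by blast
      have "g = phi ar V eqs X h"
      proof (rule extensionalityI[of _ "univ X"])
        show "g \<in> extensional (univ X)" using g by (auto simp: hom_rel_def PiE_def)
        show "phi ar V eqs X h \<in> extensional (univ X)" by (simp add: phi_def)
        show "g x = phi ar V eqs X h x" if "x \<in> univ X" for x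
          using that by (simp add: app eta_def ev terms.intros)
      qed
      with h show "g \<in> phi ar V eqs X ` hom_alg ar (F_obj ar V eqs X) B" by blast
    qed
  qed
qed

end

section \<open>The action of \<open>F\<close> on morphisms\<close>

context
  fixes ar :: "'f \<Rightarrow> nat" and V :: "('f, 'u) alg set" and n :: nat
    and eqs :: "(('f, nat) trm \<times> ('f, nat) trm) list" and X :: "'v relstr" and Y :: "'w relstr"
    and f :: "'v \<Rightarrow> 'w"
  assumes X: "presentation ar n eqs X" and Y: "presentation ar n eqs Y"
    and f: "f \<in> hom_rel X Y"
begin

text \<open>The homomorphism extending \<open>\<eta>\<^sub>Y \<circ> f\<close> witnesses that \<open>F_mor\<close> is well defined.\<close>

lemma F_mor_hom_cls:
  shows "F_mor ar V eqs X Y f \<in> hom_alg ar (F_obj ar V eqs X) (F_obj ar V eqs Y)"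
    and "t \<in> terms ar (univ X) \<Longrightarrow>
      F_mor ar V eqs X Y f (cls ar V eqs X t) = cls ar V eqs Y (map_trm id f t)"
proof -
  interpret X: presentation ar V n eqs X by (rule X)
  interpret Y: presentation ar V n eqs Y by (rule Y)
  let ?g = "compose (univ X) (eta ar V eqs Y) f"
  have img: "f ` univ X \<subseteq> univ Y" using f by (auto simp: hom_rel_def)
  have "\<forall>xs \<in> rel X. set xs \<subseteq> univ X" using X.rel_tuples by (auto simp: tuples_def)
  from hom_rel_compose[OF f Y.eta_hom this]
  have "?g \<in> hom_rel X (U_obj n eqs (F_obj ar V eqs Y))" .
  from X.F_obj_extend[OF Y.in_variety_F_obj this]
  obtain h where h: "h \<in> hom_alg ar (F_obj ar V eqs X) (F_obj ar V eqs Y)"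
    and ev: "\<And>t. t \<in> terms ar (univ X) \<Longrightarrow> h (cls ar V eqs X t) = eval (F_obj ar V eqs Y) ?g t"
    by blast
  have hcls: "h (cls ar V eqs X t) = cls ar V eqs Y (map_trm id f t)"
    if t: "t \<in> terms ar (univ X)" for t
  proof -
    have "eval (F_obj ar V eqs Y) ?g t = eval (F_obj ar V eqs Y) (\<lambda>x. eta ar V eqs Y (f x)) t"
      by (rule eval_cong[OF t]) (simp add: compose_eq)
    also have "\<dots> = eval (F_obj ar V eqs Y) (eta ar V eqs Y) (map_trm id f t)"
      by (simp add: eval_map_trm)
    also have "\<dots> = cls ar V eqs Y (map_trm id f t)"
      by (rule Y.eval_eta[OF map_trm_terms[OF t img]])
    finally show ?thesis by (simp add: ev t)
  qed
  have "F_mor ar V eqs X Y f = h"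
  proof (rule extensionalityI[of _ "car (F_obj ar V eqs X)"])
    fix C assume C: "C \<in> car (F_obj ar V eqs X)"
    then obtain t where t: "t \<in> terms ar (univ X)" "C = cls ar V eqs X t"
      by (auto simp: X.car_F_obj)
    \<comment> \<open>Several terms may represent \<open>C\<close>, but by \<open>hcls\<close> each
      yields the value \<open>h C\<close>.\<close>
    have "(THE D. \<exists>t \<in> terms ar (univ X). C = cls ar V eqs X t
        \<and> D = cls ar V eqs Y (map_trm id f t)) = h C"
    proof (rule the_equality)
      show "\<exists>t \<in> terms ar (univ X). C = cls ar V eqs X t \<and> h C = cls ar V eqs Y (map_trm id f t)"
        using t hcls by blast
    qed (use hcls in auto)
    with C show "F_mor ar V eqs X Y f C = h C" by (simp add: F_mor_def)
  qed (use h in \<open>auto simp: F_mor_def hom_alg_def PiE_def\<close>)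
  then show "F_mor ar V eqs X Y f \<in> hom_alg ar (F_obj ar V eqs X) (F_obj ar V eqs Y)"
    and "t \<in> terms ar (univ X) \<Longrightarrow>
      F_mor ar V eqs X Y f (cls ar V eqs X t) = cls ar V eqs Y (map_trm id f t)"
    using h hcls by auto
qed

text \<open>Naturality of \<open>eta\<close>, taken pointwise. With \<open>hom_ext\<close> it yields
  both functor laws, and it makes \<open>phi\<close> natural in \<open>X\<close>.\<close>

lemma F_mor_eta:
  assumes "x \<in> univ X"
  shows "F_mor ar V eqs X Y f (eta ar V eqs X x) = eta ar V eqs Y (f x)"
proof -
  have "f x \<in> univ Y" using f assms by (auto simp: hom_rel_def)
  with assms show ?thesis by (simp add: eta_def F_mor_hom_cls terms.intros)
qed

end

lemma F_mor_id:
  fixes V :: "('f, 'u) alg set"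
  assumes "presentation ar n eqs X"
  shows "F_mor ar V eqs X X (\<lambda>a \<in> univ X. a) = (\<lambda>c \<in> car (F_obj ar V eqs X). c)"
proof -
  interpret X: presentation ar V n eqs X by (rule assms)
  have "map (\<lambda>a \<in> univ X. a) xs = xs" if "xs \<in> rel X" for xs
    using that X.rel_tuples by (auto simp: tuples_def subset_iff intro!: map_idI)
  then have id: "(\<lambda>a \<in> univ X. a) \<in> hom_rel X X" by (auto simp: hom_rel_def)
  have "map (\<lambda>c \<in> car (F_obj ar V eqs X). c) xs = xs"
    if "xs \<in> tuples (ar g) (car (F_obj ar V eqs X))" for g xs
    using that by (auto simp: tuples_def intro!: map_idI)
  then have idF: "(\<lambda>c \<in> car (F_obj ar V eqs X). c) \<in> hom_alg ar (F_obj ar V eqs X) (F_obj ar V eqs X)"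
    by (auto simp: hom_alg_def interp_closed[OF X.is_alg_F_obj])
  \<comment> \<open>Both sides are homomorphisms that fix every generator.\<close>
  show ?thesis
    by (rule X.hom_ext[OF F_mor_hom_cls(1)[OF assms assms id] idF])
      (simp add: F_mor_eta[OF assms assms id] X.eta_closed)
qed

lemma F_mor_compose:
  fixes V :: "('f, 'u) alg set"
  assumes X: "presentation ar n eqs X" and Y: "presentation ar n eqs Y"
    and Z: "presentation ar n eqs Z" and f: "f \<in> hom_rel X Y" and g: "g \<in> hom_rel Y Z"
  shows "F_mor ar V eqs X Z (compose (univ X) g f)
    = compose (car (F_obj ar V eqs X)) (F_mor ar V eqs Y Z g) (F_mor ar V eqs X Y f)"
proof -
  interpret X: presentation ar V n eqs X by (rule X)
  have gf: "compose (univ X) g f \<in> hom_rel X Z"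
    using X.rel_tuples by (intro hom_rel_compose[OF f g]) (auto simp: tuples_def)
  have "f x \<in> univ Y" if "x \<in> univ X" for x using that f by (auto simp: hom_rel_def)
  \<comment> \<open>By uniqueness it suffices to compare generators: both sides send that of
    \<open>x\<close> to that of \<open>g (f x)\<close>.\<close>
  then show ?thesis
    by (intro X.hom_ext[OF F_mor_hom_cls(1)[OF X Z gf]
          hom_alg_compose[OF X.is_alg_F_obj F_mor_hom_cls(1)[OF X Y f] F_mor_hom_cls(1)[OF Y Z g]]])
      (simp add: compose_eq X.eta_closed F_mor_eta[OF X Z gf] F_mor_eta[OF X Y f] F_mor_eta[OF Y Z g])
qed

section \<open>Naturality of \<open>phi\<close>\<close>

lemma phi_natural_left:
  fixes V :: "('f, 'u) alg set"
  assumes X: "presentation ar n eqs X" and Y: "presentation ar n eqs Y" and g: "g \<in> hom_rel Y X"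
  shows "phi ar V eqs Y (compose (car (F_obj ar V eqs Y)) f (F_mor ar V eqs Y X g))
    = compose (univ Y) (phi ar V eqs X f) g"
proof -
  interpret Y: presentation ar V n eqs Y by (rule Y)
  have "g y \<in> univ X" if "y \<in> univ Y" for y using that g by (auto simp: hom_rel_def)
  \<comment> \<open>At \<open>y\<close>, both sides are \<open>f\<close> applied to the generator of
    \<open>g y\<close>, by naturality of \<open>eta\<close>.\<close>
  then show ?thesis
    by (auto simp: phi_def U_mor_def compose_def Y.eta_closed F_mor_eta[OF Y X g] fun_eq_iff)
qed

lemma phi_natural_right:
  fixes V :: "('f, 'u) alg set"
  assumes "presentation ar n eqs X"
  shows "phi ar V eqs X (compose (car (F_obj ar V eqs X)) h f)
    = compose (univ X) (U_mor h) (phi ar V eqs X f)"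
proof -
  interpret presentation ar V n eqs X by (rule assms)
  show ?thesis by (auto simp: phi_def U_mor_def compose_def eta_closed fun_eq_iff)
qed

text \<open>Here the definability of the relation enters: it makes \<open>solutions\<close> recover
  \<open>srel M\<close>, so that \<open>U\<close> stays within the relational reducts.\<close>

lemma U_obj_truncate:
  assumes "is_lstruct ar n M"
    and "\<forall>xs \<in> tuples n (car M).
      xs \<in> srel M \<longleftrightarrow> (\<forall>(t, s) \<in> set eqs. eval M ((!) xs) t = eval M ((!) xs) s)"
  shows "U_obj n eqs (alg.truncate M) = \<lparr>univ = car M, rel = srel M\<rparr>"
proof -
  have "car (alg.truncate M) = car M" by (simp add: alg.truncate_def)
  moreover have "solutions n eqs (alg.truncate M) = srel M"
    using assms unfolding solutions_def eval_truncate
    by (auto simp: is_lstruct_def alg.truncate_def)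
  ultimately show ?thesis by (simp add: U_obj_def)
qed

theorem theorem3p12:
  fixes ar :: "'f \<Rightarrow> nat"
    and n :: nat
    and eqs :: "(('f, nat) trm \<times> ('f, nat) trm) list"
    and K :: "('f, 'u) lstruct set"
  assumes terms_eqs: "set eqs \<subseteq> terms ar {..<n} \<times> terms ar {..<n}"
    and structures: "\<forall>M \<in> K. is_lstruct ar n M"
    and R_defined: "\<forall>M \<in> K. \<forall>xs \<in> tuples n (car M).
      xs \<in> srel M \<longleftrightarrow> (\<forall>(t, s) \<in> set eqs. eval M ((!) xs) t = eval M ((!) xs) s)"
    and variety: "variety ar (Kalg K)"
  shows
    \<comment> \<open>\<open>U\<close> is a functor\<close>
    "(\<forall>A \<in> Kalg K. U_obj n eqs A \<in> Krel K) \<and>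
     (\<forall>A \<in> Kalg K. \<forall>B \<in> Kalg K. \<forall>h \<in> hom_alg ar A B.
        U_mor h \<in> hom_rel (U_obj n eqs A) (U_obj n eqs B)) \<and>
     (\<forall>A \<in> Kalg K. U_mor (\<lambda>a \<in> car A. a) = (\<lambda>a \<in> univ (U_obj n eqs A). a)) \<and>
     (\<forall>A \<in> Kalg K. \<forall>B \<in> Kalg K. \<forall>C \<in> Kalg K. \<forall>h \<in> hom_alg ar A B. \<forall>k \<in> hom_alg ar B C.
        U_mor (compose (car A) k h) = compose (univ (U_obj n eqs A)) (U_mor k) (U_mor h)) \<and>
     \<comment> \<open>\<open>F\<close> is a functor\<close>
     (\<forall>X \<in> Krel K. in_variety ar (Kalg K) (F_obj ar (Kalg K) eqs X)) \<and>
     (\<forall>X \<in> Krel K. \<forall>Y \<in> Krel K. \<forall>f \<in> hom_rel X Y.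
        F_mor ar (Kalg K) eqs X Y f
          \<in> hom_alg ar (F_obj ar (Kalg K) eqs X) (F_obj ar (Kalg K) eqs Y) \<and>
        (\<forall>t \<in> terms ar (univ X). F_mor ar (Kalg K) eqs X Y f (cls ar (Kalg K) eqs X t)
           = cls ar (Kalg K) eqs Y (map_trm id f t))) \<and>
     (\<forall>X \<in> Krel K. F_mor ar (Kalg K) eqs X X (\<lambda>a \<in> univ X. a)
        = (\<lambda>c \<in> car (F_obj ar (Kalg K) eqs X). c)) \<and>
     (\<forall>X \<in> Krel K. \<forall>Y \<in> Krel K. \<forall>Z \<in> Krel K. \<forall>f \<in> hom_rel X Y. \<forall>g \<in> hom_rel Y Z.
        F_mor ar (Kalg K) eqs X Z (compose (univ X) g f)
        = compose (car (F_obj ar (Kalg K) eqs X))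
            (F_mor ar (Kalg K) eqs Y Z g) (F_mor ar (Kalg K) eqs X Y f)) \<and>
     \<comment> \<open>\<open>\<eta>\<^sub>X\<close> is a morphism\<close>
     (\<forall>X \<in> Krel K. eta ar (Kalg K) eqs X \<in> hom_rel X (U_obj n eqs (F_obj ar (Kalg K) eqs X))) \<and>
     \<comment> \<open>\<open>\<phi>\<close> is bijective\<close>
     (\<forall>X \<in> Krel K. \<forall>A \<in> Kalg K.
        bij_betw (phi ar (Kalg K) eqs X)
          (hom_alg ar (F_obj ar (Kalg K) eqs X) A) (hom_rel X (U_obj n eqs A))) \<and>
     \<comment> \<open>\<open>\<phi>\<close> is natural in \<open>X\<close>\<close>
     (\<forall>X \<in> Krel K. \<forall>Y \<in> Krel K. \<forall>A \<in> Kalg K. \<forall>g \<in> hom_rel Y X.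
        \<forall>f \<in> hom_alg ar (F_obj ar (Kalg K) eqs X) A.
        phi ar (Kalg K) eqs Y
          (compose (car (F_obj ar (Kalg K) eqs Y)) f (F_mor ar (Kalg K) eqs Y X g))
        = compose (univ Y) (phi ar (Kalg K) eqs X f) g) \<and>
     \<comment> \<open>\<open>\<phi>\<close> is natural in \<open>A\<close>\<close>
     (\<forall>X \<in> Krel K. \<forall>A \<in> Kalg K. \<forall>B \<in> Kalg K. \<forall>h \<in> hom_alg ar A B.
        \<forall>f \<in> hom_alg ar (F_obj ar (Kalg K) eqs X) A.
        phi ar (Kalg K) eqs X (compose (car (F_obj ar (Kalg K) eqs X)) h f)
        = compose (univ X) (U_mor h) (phi ar (Kalg K) eqs X f))"
proof -
  have alg: "is_alg ar A" if "A \<in> Kalg K" for A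
    using that structures by (auto simp: Kalg_def is_lstruct_def is_alg_truncate)
  \<comment> \<open>Links members of \<open>Kalg K\<close> to the extension results, which are
    stated for algebras satisfying the identities of the class.\<close>
  then have inv: "in_variety ar (Kalg K) A" if "A \<in> Kalg K" for A
    using that by (intro in_variety_self) auto
  have pres: "presentation ar n eqs X" if "X \<in> Krel K" for X
    using that structures terms_eqs
    by (fastforce simp: Krel_def is_lstruct_def is_alg_def presentation_def)
  have U: "U_obj n eqs A \<in> Krel K" if "A \<in> Kalg K" for A
    using that U_obj_truncate structures R_defined unfolding Kalg_def Krel_def by fastforce
  show ?thesis
    by (intro conjI ballI, simp_all add: U[unfolded U_obj_def] U_mor_def U_obj_def[of n eqs] alg inv
        hom_alg_hom_rel[OF terms_eqs, unfolded U_obj_def]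
        presentation.in_variety_F_obj[OF pres] F_mor_hom_cls[OF pres pres] F_mor_id[OF pres]
        F_mor_compose[OF pres pres pres] presentation.eta_hom[OF pres, unfolded U_obj_def]
        presentation.phi_bij[OF pres inv, unfolded U_obj_def]
        phi_natural_left[OF pres pres])
      (rule phi_natural_right[OF pres, unfolded U_mor_def])
qed

end
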